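(* Let $\varphi:\mathbb{D}\to\mathbb{D}$ be an inner function whose zero set, if infinite, forms a finite union of subsequences each tending nontangentially to a point of $\mathbb{T}$, and whose singular part is given by a (singular) measure of finite support. Then any function $h\in\mathcal{M}_\varphi$ is essentially bounded on all relatively compact subsets of $E_\varphi=\mathbb{T}\setminus\sigma(\varphi)$.
   Context: $\mathbb{D}$ is the open unit disc in $\mathbb{C}$ and $\mathbb{T}$ the unit circle. $\mathcal{H}^2$ is the Hardy space of holomorphic $f$ on $\mathbb{D}$ with $\|f\|_2^2=\sup_{0\le r<1}\int_0^{2\pi}|f(re^{i\theta})|^2\,\frac{d\theta}{2\pi}<\infty$; functions in it are identified with their radial limits a.e. on $\mathbb{T}$. For analytic $\varphi:\mathbb{D}\to\mathbb{D}$, the multiplier space is $\mathcal{M}_\varphi=\{h\in\mathcal{H}^2: W_{h,\varphi}\text{ is bounded on }\mathcal{H}^2\}$, where $W_{h,\varphi}f(z)=h(z)f(\varphi(z))$. An inner function $\varphi$ has the canonical representation $$\varphi(z)=e^{i\alpha}z^N\prod_{n\ge1}\frac{|a_n|}{a_n}\frac{a_n-z}{1-\overline{a_n}z}\exp\left(-\int_{\mathbb{T}}\frac{\zeta+z}{\zeta-z}\,d\mu(\zeta)\right),$$ with $\alpha\in\mathbb{R}$, $N\in\mathbb{N}\cup\{0\}$, $\{a_n\}$ the nonzero zeros of $\varphi$ (with multiplicity) and $\mu$ a finite positive measure on $\mathbb{T}$ singular with respect to Lebesgue measure; the exponential factor is the singular part. The spectrum of $\varphi$ is $\sigma(\varphi)=\operatorname{clos}\{a_n\}_n\cup\operatorname{supp}\mu$.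 The Ahern–Clark set is $$E_\varphi=\left\{\zeta\in\mathbb{T}:\sum_{n\ge1}\frac{1-|a_n|^2}{|\zeta-a_n|^2}+2\int_{\mathbb{T}}\frac{d\mu(t)}{|t-\zeta|^2}<\infty\right\}.$$ A relatively compact subset of $E_\varphi$ is one whose closure is a compact subset of $E_\varphi$. *)

theory Defs
  imports "HOL-Complex_Analysis.Complex_Analysis" "HOL-Probability.Probability"
begin

abbreviation unit_disc :: "complex set" where
  "unit_disc \<equiv> ball 0 1"

abbreviation unit_circle :: "complex set" where
  "unit_circle \<equiv> sphere 0 1"

text \<open>Normalised arc length (Lebesgue measure) on the unit circle.\<close>

definition circle_measure :: "complex measure" where
  "circle_measure =
     distr (uniform_measure lborel {0..<2 * pi}) (restrict_space borel unit_circle) cis"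

text \<open>
  Functions on the disc are represented by functions on the whole complex plane; their values
  outside the disc are never used.  The boundary function is therefore always the radial limit
  below.  By Fatou's theorem this limit exists almost everywhere for functions in the Hardy space,
  so that the unspecified value of \<^const>\<open>Lim\<close> at points without a radial limit concerns a null set
  only.
\<close>

definition radial_limit :: "(complex \<Rightarrow> complex) \<Rightarrow> complex \<Rightarrow> complex" where
  "radial_limit f \<zeta> = Lim (at_left (1::real)) (\<lambda>r. f (of_real r * \<zeta>))"

definition essentially_bounded_on :: "(complex \<Rightarrow> complex) \<Rightarrow> complex set \<Rightarrow> bool" where
  "essentially_bounded_on f K \<longleftrightarrow>
     (\<exists>M. AE \<zeta> in circle_measure. \<zeta> \<in> K \<longrightarrow> norm (radial_limit f \<zeta>) \<le> M)"

definition hardy2_mean :: "(complex \<Rightarrow> complex) \<Rightarrow> real \<Rightarrow> real" where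
  "hardy2_mean f r = integral {0..2 * pi} (\<lambda>t. (norm (f (of_real r * cis t)))\<^sup>2) / (2 * pi)"

definition hardy2 :: "(complex \<Rightarrow> complex) set" where
  "hardy2 = {f. f holomorphic_on unit_disc \<and> bdd_above (hardy2_mean f ` {0..<1})}"

definition hardy2_norm :: "(complex \<Rightarrow> complex) \<Rightarrow> real" where
  "hardy2_norm f = sqrt (SUP r\<in>{0..<1}. hardy2_mean f r)"

definition weighted_composition ::
    "(complex \<Rightarrow> complex) \<Rightarrow> (complex \<Rightarrow> complex) \<Rightarrow> (complex \<Rightarrow> complex) \<Rightarrow> complex \<Rightarrow> complex" where
  "weighted_composition h \<phi> f = (\<lambda>z. h z * f (\<phi> z))"

definition multiplier_space :: "(complex \<Rightarrow> complex) \<Rightarrow> (complex \<Rightarrow> complex) set" where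
  "multiplier_space \<phi> =
     {h \<in> hardy2. \<exists>C. \<forall>f\<in>hardy2. weighted_composition h \<phi> f \<in> hardy2 \<and>
                      hardy2_norm (weighted_composition h \<phi> f) \<le> C * hardy2_norm f}"

text \<open>Mapping the disc into the open disc excludes the unimodular constants.\<close>

definition inner_function :: "(complex \<Rightarrow> complex) \<Rightarrow> bool" where
  "inner_function \<phi> \<longleftrightarrow> \<phi> holomorphic_on unit_disc \<and> \<phi> ` unit_disc \<subseteq> unit_disc \<and>
     (AE \<zeta> in circle_measure. norm (radial_limit \<phi> \<zeta>) = 1)"

definition singular_circle_measure :: "complex measure \<Rightarrow> bool" where
  "singular_circle_measure \<mu> \<longleftrightarrow>
     finite_measure \<mu> \<and> sets \<mu> = sets (restrict_space borel unit_circle) \<and>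
     (\<exists>A\<in>sets \<mu>. emeasure circle_measure A = 0 \<and> emeasure \<mu> (unit_circle - A) = 0)"

definition measure_support :: "'a::topological_space measure \<Rightarrow> 'a set" where
  "measure_support \<mu> =
     {x \<in> space \<mu>. \<forall>U. open U \<and> x \<in> U \<longrightarrow> emeasure \<mu> (U \<inter> space \<mu>) > 0}"

definition blaschke_factor :: "complex \<Rightarrow> complex \<Rightarrow> complex" where
  "blaschke_factor w z = of_real (norm w) / w * ((w - z) / (1 - cnj w * z))"

text \<open>
  The nonzero zeros, repeated according to multiplicity, are listed as \<open>a n\<close> with \<open>n\<close> ranging over
  an index set \<open>I\<close> of natural numbers, so that no, finitely many or infinitely many zeros are
  covered alike.  That \<open>a\<close> lists exactly the nonzero zeros of \<open>\<phi>\<close> with their multiplicities, and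
  the Blaschke condition, are consequences of the product formula: \<^const>\<open>has_prod\<close> permits only
  finitely many vanishing factors and requires the product of the others to converge to a nonzero
  value.
\<close>

definition canonical_representation ::
    "(complex \<Rightarrow> complex) \<Rightarrow> real \<Rightarrow> nat \<Rightarrow> nat set \<Rightarrow> (nat \<Rightarrow> complex) \<Rightarrow> complex measure \<Rightarrow> bool" where
  "canonical_representation \<phi> \<alpha> N I a \<mu> \<longleftrightarrow>
     (\<forall>n\<in>I. a n \<in> unit_disc - {0}) \<and> singular_circle_measure \<mu> \<and>
     (\<forall>z\<in>unit_disc. \<exists>B. (\<lambda>n. if n \<in> I then blaschke_factor (a n) z else 1) has_prod B \<and>
        \<phi> z = cis \<alpha> * z ^ N * B * exp (- (LINT \<zeta>|\<mu>. (\<zeta> + z) / (\<zeta> - z))))"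

definition inner_spectrum :: "nat set \<Rightarrow> (nat \<Rightarrow> complex) \<Rightarrow> complex measure \<Rightarrow> complex set" where
  "inner_spectrum I a \<mu> = closure (a ` I) \<union> measure_support \<mu>"

text \<open>
  Computed in \<^typ>\<open>ennreal\<close>, where \<open>1 / 0 = \<infinity>\<close>: an atom of \<open>\<mu>\<close> at \<open>\<zeta>\<close> makes the integral infinite.
\<close>

definition ahern_clark_set :: "nat set \<Rightarrow> (nat \<Rightarrow> complex) \<Rightarrow> complex measure \<Rightarrow> complex set" where
  "ahern_clark_set I a \<mu> =
     {\<zeta> \<in> unit_circle.
        (\<Sum>\<^sub>\<infinity>n\<in>I. ennreal ((1 - (norm (a n))\<^sup>2) / (norm (\<zeta> - a n))\<^sup>2))
        + 2 * (\<integral>\<^sup>+t. 1 / ennreal ((norm (t - \<zeta>))\<^sup>2) \<partial>\<mu>) < \<infinity>}"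

text \<open>Convergence to \<open>\<zeta>\<close> from within a nontangential approach region (Stolz angle) at \<open>\<zeta>\<close>.\<close>

definition tends_nontangentially :: "(nat \<Rightarrow> complex) \<Rightarrow> complex \<Rightarrow> bool" where
  "tends_nontangentially s \<zeta> \<longleftrightarrow> s \<longlonglongrightarrow> \<zeta> \<and>
     (\<exists>C. \<forall>\<^sub>F n in sequentially. s n \<in> unit_disc \<and> norm (\<zeta> - s n) \<le> C * (1 - norm (s n)))"

definition finite_union_of_nontangential_subsequences :: "nat set \<Rightarrow> (nat \<Rightarrow> complex) \<Rightarrow> bool" where
  "finite_union_of_nontangential_subsequences I a \<longleftrightarrow>
     (\<exists>(m::nat) r. I = (\<Union>k<m. range (r k)) \<and>
        (\<forall>k<m. strict_mono (r k) \<and>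
               (\<exists>\<zeta>\<in>unit_circle. tends_nontangentially (\<lambda>j. a (r k j)) \<zeta>)))"

definition relatively_compact_in :: "'a::topological_space set \<Rightarrow> 'a set \<Rightarrow> bool" where
  "relatively_compact_in K E \<longleftrightarrow> compact (closure K) \<and> closure K \<subseteq> E"

end

theory Submission
  imports Defs
begin

text \<open>
  Testing the boundedness of the weighted composition operator on the Cauchy kernel at \<open>\<phi> z\<close>
  and evaluating at \<open>z\<close> gives \<open>\<bar>h z\<bar>\<^sup>2 \<le> C (1 - \<bar>\<phi> z\<bar>\<^sup>2) / (1 - \<bar>z\<bar>)\<close>.  Each factor of the
  canonical product has modulus at most 1, so \<open>1 - \<bar>\<phi>\<bar>\<^sup>2\<close> is at most the sum of the corresponding
  defects of the factors; on the radius to \<open>\<zeta>\<close>, and close to \<open>\<zeta>\<close>, this sum is at most a constant,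
  depending only on \<open>\<phi>\<close> and the distance of \<open>\<zeta>\<close> to the spectrum, times \<open>1 - \<bar>z\<bar>\<close>.  Hence \<open>h\<close> is
  uniformly bounded near the ends of the radii to a compact set off the spectrum.

  At a point of the spectrum on the circle the Ahern-Clark sum is infinite, since the singular
  measure has an atom there or the zeros accumulate nontangentially, in which case the terms
  themselves are unbounded.
\<close>

section \<open>Radial limits and the default value of \<open>Lim\<close>\<close>

text \<open>
  Where the radial limit does not exist, \<^const>\<open>Lim\<close> takes a value that does not depend on the
  function.  Bounds on radial limits therefore hold at every point, without Fatou's theorem.
\<close>

lemma Lim_tendsto_or_undefined:
  assumes "F \<noteq> bot"
  shows "(f \<longlongrightarrow> Lim F f) F \<or> Lim F f = (THE l. False)"
proof (cases "\<exists>l. (f \<longlongrightarrow> l) F")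
  case True
  then show ?thesis using tendsto_Lim[OF assms] by metis
next
  case False
  \<comment> \<open>\<open>Lim\<close> is a definite description; with no limit at all its predicate
    is the constant \<open>False\<close>, so its value is one fixed number, whatever
    \<open>f\<close> and \<open>F\<close> are.\<close>
  then have "(\<lambda>l. (f \<longlongrightarrow> l) F) = (\<lambda>l. False)"
    by auto
  then show ?thesis unfolding t2_space_class.Lim_def by simp
qed

lemma norm_radial_limit_le:
  assumes "\<And>r. r0 \<le> r \<Longrightarrow> r < 1 \<Longrightarrow> norm (f (of_real r * \<zeta>)) \<le> M" "r0 < 1"
  shows "norm (radial_limit f \<zeta>) \<le> max M (norm (THE l::complex. False))"
proof -
  have "norm (radial_limit f \<zeta>) \<le> M"
    if "((\<lambda>r. f (of_real r * \<zeta>)) \<longlongrightarrow> radial_limit f \<zeta>) (at_left (1::real))"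
  proof (rule tendsto_upperbound[OF tendsto_norm[OF that]])
    have "\<forall>\<^sub>F r in at_left (1::real). r \<in> {r0<..<1}"
      using assms(2) by (rule eventually_at_left_real)
    then show "\<forall>\<^sub>F r in at_left 1. norm (f (of_real r * \<zeta>)) \<le> M"
      by eventually_elim (use assms(1) in auto)
  qed simp
  moreover have "((\<lambda>r. f (of_real r * \<zeta>)) \<longlongrightarrow> radial_limit f \<zeta>) (at_left (1::real))
      \<or> radial_limit f \<zeta> = (THE l. False)"
    unfolding radial_limit_def by (rule Lim_tendsto_or_undefined) simp
  ultimately show ?thesis
    by (metis le_max_iff_disj order_refl)
qed

section \<open>Integral means and the Hardy norm\<close>

lemma hardy2_mean_nonneg: "0 \<le> hardy2_mean f r"
proof -
  \<comment> \<open>A non-integrable function has integral 0 by convention, so no regularity of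
    \<open>f\<close> enters here.\<close>
  have "0 \<le> integral {0..2 * pi} (\<lambda>t. (norm (f (of_real r * cis t)))\<^sup>2)"
    by (metis (lifting) integral_nonneg not_integrable_integral order_refl zero_le_power2)
  then show ?thesis by (simp add: hardy2_mean_def)
qed

lemma hardy2_mean_le_norm:
  assumes "f \<in> hardy2" "0 \<le> r" "r < 1"
  shows "hardy2_mean f r \<le> (hardy2_norm f)\<^sup>2"
proof -
  have "hardy2_mean f r \<le> (SUP r\<in>{0..<1}. hardy2_mean f r)"
    using assms unfolding hardy2_def by (intro cSUP_upper) auto
  with hardy2_mean_nonneg[of f r] show ?thesis
    by (simp add: hardy2_norm_def)
qed

lemma hardy2_norm_nonneg:
  assumes "f \<in> hardy2"
  shows "0 \<le> hardy2_norm f"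
proof -
  have "0 \<le> (SUP r\<in>{0..<1}. hardy2_mean f r)"
    using assms hardy2_mean_nonneg[of f] unfolding hardy2_def
    by (intro cSUP_upper2[where x = 0]) auto
  then show ?thesis by (simp add: hardy2_norm_def)
qed

lemma hardy2_norm_sq_le:
  assumes "\<And>r. 0 \<le> r \<Longrightarrow> r < 1 \<Longrightarrow> hardy2_mean f r \<le> M"
  shows "(hardy2_norm f)\<^sup>2 \<le> M"
proof -
  have "0 \<le> hardy2_mean f 0" by (rule hardy2_mean_nonneg)
  also have "hardy2_mean f 0 \<le> M" using assms by simp
  finally have "0 \<le> M" .
  have sup: "(SUP r\<in>{0..<1}. hardy2_mean f r) \<le> M"
    using assms by (intro cSUP_least) auto
  have "0 \<le> (SUP r\<in>{0..<1}. hardy2_mean f r)"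
    using assms hardy2_mean_nonneg[of f]
    by (intro cSUP_upper2[where x = 0] bdd_aboveI2[where M = M]) auto
  then show ?thesis
    unfolding hardy2_norm_def using sup by (subst real_sqrt_pow2)
qed

section \<open>Cauchy kernels and point evaluation\<close>

text \<open>Cauchy's integral formula along the parametrised circle. The extra factor
  \<open>of_real R * cis t\<close> comes from du = i R e^(it) dt, and multiplying by -i removes the
  i on both sides.\<close>

lemma circle_mean_value:
  assumes "continuous_on (cball 0 R) f" "f holomorphic_on ball 0 R" "norm w < R"
  shows "((\<lambda>t. f (of_real R * cis t) * (of_real R * cis t) / (of_real R * cis t - w))
           has_integral 2 * of_real pi * f w) {0..2 * pi}"
proof -
  have "((\<lambda>u. f u / (u - w)) has_contour_integral (2 * of_real pi * \<i> * f w)) (circlepath 0 R)"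
    using assms by (intro Cauchy_integral_circlepath) auto
  then have "((\<lambda>t. f (of_real R * cis t) / (of_real R * cis t - w) * of_real R * \<i> * cis t)
      has_integral 2 * of_real pi * \<i> * f w) {0..2 * pi}"
    unfolding circlepath_def by (subst (asm) has_contour_integral_part_circlepath_iff) auto
  from has_integral_mult_right[OF this, of "- \<i>"] show ?thesis
    by (simp add: algebra_simps)
qed

text \<open>Put v = r w and f(u) = 1 / (1 - \<open>cnj v\<close> u). The radius is absorbed into v,
  so the mean is that of |f|^2 over the unit circle. There |f(u)|^2 = f(u) u / (u - v), and Cauchy's
  formula returns f(v) = 1 / (1 - |v|^2).\<close>

lemma hardy2_mean_cauchy_kernel:
  assumes w: "norm w < 1" and r: "0 < r" "r < 1"
  shows "hardy2_mean (\<lambda>z. 1 / (1 - cnj w * z)) r = 1 / (1 - r\<^sup>2 * (norm w)\<^sup>2)"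
proof -
  define v where "v = of_real r * w"
  define f where "f = (\<lambda>u. 1 / (1 - cnj v * u))"
  have v: "norm v < 1"
    using assms mult_strict_mono[of r 1 "norm w" 1] by (simp add: v_def norm_mult)
  have nz: "1 - cnj v * u \<noteq> 0" if "norm u \<le> 1" for u
  proof
    assume "1 - cnj v * u = 0"
    then have "norm (cnj v * u) = 1" by (metis eq_iff_diff_eq_0 norm_one)
    moreover have "norm (cnj v * u) \<le> norm v * 1"
      unfolding norm_mult complex_mod_cnj using that by (intro mult_left_mono) auto
    ultimately show False using v by simp
  qed
  have "((\<lambda>t. f (of_real 1 * cis t) * (of_real 1 * cis t) / (of_real 1 * cis t - v))
           has_integral 2 * of_real pi * f v) {0..2 * pi}"
    using nz v unfolding f_def
    by (intro circle_mean_value holomorphic_on_imp_continuous_on) (auto intro!: holomorphic_intros continuous_intros)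
  moreover have "f (of_real 1 * cis t) * (of_real 1 * cis t) / (of_real 1 * cis t - v)
      = of_real ((norm (1 / (1 - cnj w * (of_real r * cis t))))\<^sup>2)" for t
  proof -
    have 1: "1 - v * cnj (cis t) \<noteq> 0" and 2: "1 - cnj v * cis t \<noteq> 0"
      using nz[of "cis t"] by (auto simp: complex_eq_iff algebra_simps)
    \<comment> \<open>As \<open>cnj (cis t)\<close> inverts \<open>cis t\<close>, the quotient
      \<open>cis t / (cis t - v)\<close> is the conjugate of \<open>f (cis t)\<close>.\<close>
    have "cis t - v = cis t * (1 - v * cnj (cis t))"
      by (simp add: algebra_simps cis_cnj cis_mult)
    moreover have "of_real ((norm (1 / (1 - cnj w * (of_real r * cis t))))\<^sup>2)
        = 1 / ((1 - cnj v * cis t) * (1 - v * cnj (cis t)))"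
      by (simp add: v_def complex_norm_square norm_divide power_divide flip: of_real_power)
        (simp add: complex_norm_square algebra_simps)
    ultimately show ?thesis
      using 1 2 by (simp add: f_def)
  qed
  moreover have "2 * of_real pi * f v = of_real (2 * pi * (1 / (1 - r\<^sup>2 * (norm w)\<^sup>2)))"
    using complex_norm_square[of w] by (simp add: f_def v_def power2_eq_square algebra_simps)
  ultimately have "((\<lambda>t. complex_of_real ((norm (1 / (1 - cnj w * (of_real r * cis t))))\<^sup>2))
     has_integral of_real (2 * pi * (1 / (1 - r\<^sup>2 * (norm w)\<^sup>2)))) {0..2 * pi}"
    by simp
  from has_integral_Re[OF this] show ?thesis
    unfolding hardy2_mean_def by (simp add: integral_unique)
qed

lemma cauchy_kernel_hardy2:
  assumes w: "norm w < 1"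
  shows "(\<lambda>z. 1 / (1 - cnj w * z)) \<in> hardy2" (is ?mem)
    and "(hardy2_norm (\<lambda>z. 1 / (1 - cnj w * z)))\<^sup>2 \<le> 1 / (1 - (norm w)\<^sup>2)" (is ?norm)
proof -
  have w2: "(norm w)\<^sup>2 < 1" using w by (simp add: power_less_one_iff)
  have mean: "hardy2_mean (\<lambda>z. 1 / (1 - cnj w * z)) r \<le> 1 / (1 - (norm w)\<^sup>2)"
    if "0 \<le> r" "r < 1" for r
  proof (cases "r = 0")
    case True
    then show ?thesis using w2 by (simp add: hardy2_mean_def)
  next
    case False
    have "r\<^sup>2 * (norm w)\<^sup>2 \<le> 1 * (norm w)\<^sup>2"
      using that by (intro mult_right_mono) (auto simp: power_le_one)
    with False that w2 show ?thesis
      by (subst hardy2_mean_cauchy_kernel[OF w]) (auto intro!: divide_left_mono mult_pos_pos)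
  qed
  have "1 - cnj w * z \<noteq> 0" if "norm z < 1" for z
  proof
    assume "1 - cnj w * z = 0"
    then have "norm w * norm z = 1" by (metis eq_iff_diff_eq_0 norm_one norm_mult complex_mod_cnj)
    with w that show False
      by (metis mult_left_le_one_le norm_ge_zero less_imp_le linorder_not_less)
  qed
  then have "(\<lambda>z. 1 / (1 - cnj w * z)) holomorphic_on unit_disc"
    by (intro holomorphic_intros) auto
  with mean show ?mem
    unfolding hardy2_def by (auto intro!: bdd_aboveI2)
  show ?norm using mean by (rule hardy2_norm_sq_le)
qed

text \<open>Cauchy's formula is applied to g^2 rather than g, so that the mean of |g|^2 appears at
  once; the kernel R / |R e^(it) - z| is at most 1 / (1 - |z| / R). The sharp factor would be 1 -
  |z|^2, which differs from 1 - |z| by less than a factor 2.\<close>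

lemma hardy2_point_evaluation:
  assumes g: "g \<in> hardy2" and z: "norm z < 1"
  shows "(norm (g z))\<^sup>2 * (1 - norm z) \<le> (hardy2_norm g)\<^sup>2"
proof -
  have hol: "g holomorphic_on unit_disc" using g by (simp add: hardy2_def)
  have bound: "(norm (g z))\<^sup>2 * (1 - norm z / R) \<le> (hardy2_norm g)\<^sup>2"
    if R: "norm z < R" "R < 1" for R
  proof -
    have "0 < R" using R norm_ge_zero[of z] by linarith
    have sub: "cball 0 R \<subseteq> unit_disc" using R by auto
    have cont: "continuous_on (cball 0 R) g"
      using hol sub holomorphic_on_imp_continuous_on holomorphic_on_subset by blast
    have holR: "g holomorphic_on ball 0 R"
      using hol sub by (meson ball_subset_cball holomorphic_on_subset order_trans)
    have "((\<lambda>t. (g (of_real R * cis t))\<^sup>2 * (of_real R * cis t) / (of_real R * cis t - z))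
           has_integral 2 * of_real pi * (g z)\<^sup>2) {0..2 * pi}"
      using circle_mean_value[of R "\<lambda>u. (g u)\<^sup>2" z] cont holR R
      by (auto intro!: holomorphic_intros continuous_intros)
    moreover have cont2: "continuous_on {0..2 * pi} (\<lambda>t. (norm (g (of_real R * cis t)))\<^sup>2)"
      using \<open>0 < R\<close>
      by (intro continuous_intros continuous_on_compose2[OF cont]) (auto simp: norm_mult)
    have "((\<lambda>t. (norm (g (of_real R * cis t)))\<^sup>2 / (1 - norm z / R)) has_integral
            (2 * pi * hardy2_mean g R) / (1 - norm z / R)) {0..2 * pi}"
      using integrable_integral[OF integrable_continuous_real[OF cont2]]
      by (intro has_integral_divide) (simp add: hardy2_mean_def)
    moreover have "norm ((g (of_real R * cis t))\<^sup>2 * (of_real R * cis t) / (of_real R * cis t - z))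
        \<le> (norm (g (of_real R * cis t)))\<^sup>2 / (1 - norm z / R)" for t
    proof -
      have "R - norm z \<le> norm (of_real R * cis t - z)"
        using norm_triangle_ineq2[of "of_real R * cis t" z] \<open>0 < R\<close> by (simp add: norm_mult)
      then have "R / norm (of_real R * cis t - z) \<le> R / (R - norm z)"
        using R \<open>0 < R\<close> by (intro frac_le) auto
      also have "R / (R - norm z) = 1 / (1 - norm z / R)"
        using R \<open>0 < R\<close> by (simp add: field_simps)
      finally show ?thesis
        using \<open>0 < R\<close> mult_left_mono[of "R / norm (of_real R * cis t - z)" "1 / (1 - norm z / R)"
            "(norm (g (of_real R * cis t)))\<^sup>2"]
        by (simp add: norm_mult norm_divide norm_power)
    qed
    ultimately have "norm (2 * of_real pi * (g z)\<^sup>2) \<le> (2 * pi * hardy2_mean g R) / (1 - norm z / R)"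
      by (metis (lifting) integral_norm_bound_integral has_integral_iff)
    then have "2 * pi * (norm (g z))\<^sup>2 \<le> 2 * pi * (hardy2_mean g R / (1 - norm z / R))"
      by (simp add: norm_mult norm_power)
    then have "(norm (g z))\<^sup>2 \<le> hardy2_mean g R / (1 - norm z / R)"
      by (subst (asm) mult_le_cancel_left_pos) auto
    then have "(norm (g z))\<^sup>2 * (1 - norm z / R) \<le> hardy2_mean g R"
      using R \<open>0 < R\<close> by (subst (asm) pos_le_divide_eq) auto
    also have "\<dots> \<le> (hardy2_norm g)\<^sup>2"
      using g R \<open>0 < R\<close> by (intro hardy2_mean_le_norm) auto
    finally show ?thesis .
  qed
  \<comment> \<open>The right side of \<open>bound\<close> does not depend on \<open>R\<close>, so
    \<open>R\<close> may tend to 1.\<close>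
  have "((\<lambda>R. (norm (g z))\<^sup>2 * (1 - norm z / R)) \<longlongrightarrow> (norm (g z))\<^sup>2 * (1 - norm z / 1)) (at_left 1)"
    by (intro tendsto_intros) auto
  moreover have "\<forall>\<^sub>F R in at_left 1. (norm (g z))\<^sup>2 * (1 - norm z / R) \<le> (hardy2_norm g)\<^sup>2"
    using eventually_at_left_real[OF z] by eventually_elim (use bound in auto)
  ultimately show ?thesis
    using tendsto_upperbound[of _ _ "at_left (1::real)"] by fastforce
qed

section \<open>Pointwise growth of multipliers\<close>

text \<open>With d = 1 - |w|^2, the kernel at w = \<open>\<phi> z\<close> takes the value 1/d at w,
  while its squared norm is at most 1/d. Point evaluation of its image at z thus compares |h(z)|^2 /
  d^2 with a constant times 1/d, which leaves one factor d on the right.\<close>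

lemma multiplier_pointwise_bound:
  assumes h: "h \<in> multiplier_space \<phi>" and \<phi>: "\<phi> ` unit_disc \<subseteq> unit_disc"
  obtains C where "\<And>z. norm z < 1 \<Longrightarrow> (norm (h z))\<^sup>2 * (1 - norm z) \<le> C * (1 - (norm (\<phi> z))\<^sup>2)"
    and "0 \<le> C"
proof -
  obtain C where C: "\<And>f. f \<in> hardy2 \<Longrightarrow> weighted_composition h \<phi> f \<in> hardy2 \<and>
      hardy2_norm (weighted_composition h \<phi> f) \<le> C * hardy2_norm f"
    using h unfolding multiplier_space_def by blast
  have "(norm (h z))\<^sup>2 * (1 - norm z) \<le> C\<^sup>2 * (1 - (norm (\<phi> z))\<^sup>2)" if z: "norm z < 1" for z
  proof -
    define w where "w = \<phi> z"
    define k where "k = (\<lambda>u. 1 / (1 - cnj w * u))"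
    define d where "d = 1 - (norm w)\<^sup>2"
    have w: "norm w < 1" using \<phi> z by (auto simp: w_def image_subset_iff)
    have d: "0 < d" using w by (simp add: d_def power_less_one_iff)
    have k: "k \<in> hardy2" "(hardy2_norm k)\<^sup>2 \<le> 1 / d"
      using cauchy_kernel_hardy2[OF w] by (auto simp: k_def d_def)
    let ?g = "weighted_composition h \<phi> k"
    have g: "?g \<in> hardy2" "hardy2_norm ?g \<le> C * hardy2_norm k" using C k(1) by auto
    have "?g z = h z / of_real d"
      using complex_norm_square[of w]
      by (simp add: weighted_composition_def k_def d_def w_def mult.commute)
    then have "(norm (h z))\<^sup>2 / d\<^sup>2 * (1 - norm z) \<le> (hardy2_norm ?g)\<^sup>2"
      using hardy2_point_evaluation[OF g(1) z] d by (simp add: norm_divide power_divide)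
    also have "\<dots> \<le> (C * hardy2_norm k)\<^sup>2"
      using g hardy2_norm_nonneg by (intro power_mono) auto
    also have "\<dots> \<le> C\<^sup>2 * (1 / d)"
      unfolding power_mult_distrib using k(2) by (intro mult_left_mono) auto
    finally have "((norm (h z))\<^sup>2 / d\<^sup>2 * (1 - norm z)) * d\<^sup>2 \<le> (C\<^sup>2 * (1 / d)) * d\<^sup>2"
      by (rule mult_right_mono) simp
    then have "(norm (h z))\<^sup>2 * (1 - norm z) \<le> C\<^sup>2 * d"
      using d by (simp add: power2_eq_square)
    then show ?thesis by (simp add: d_def w_def)
  qed
  \<comment> \<open>The square is nonnegative whatever the sign of the constant supplied by
    \<open>multiplier_space\<close>.\<close>
  then show thesis using that[of "C\<^sup>2"] by simp
qed

section \<open>Defects of the factors of the canonical product\<close>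

lemma Re_poisson_kernel:
  assumes "norm \<zeta> = 1"
  shows "Re ((\<zeta> + z) / (\<zeta> - z)) = (1 - (norm z)\<^sup>2) / (norm (\<zeta> - z))\<^sup>2"
proof -
  have "1 = (Re \<zeta>)\<^sup>2 + (Im \<zeta>)\<^sup>2"
    using assms cmod_power2[of \<zeta>] by simp
  then show ?thesis
    unfolding Re_divide cmod_power2 by (simp add: power2_eq_square algebra_simps)
qed

text \<open>Rests on |1 - \<open>cnj w\<close> z|^2 - |w - z|^2 = (1 - |w|^2)(1 - |z|^2). Away from
  small denominators, the defect is controlled by the term 1 - |w|^2 of the Blaschke sum times 1 -
  |z|^2.\<close>

lemma one_minus_norm_blaschke_factor:
  assumes "norm w < 1" "w \<noteq> 0" "norm z < 1"
  shows "1 - (norm (blaschke_factor w z))\<^sup>2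
           = (1 - (norm w)\<^sup>2) * (1 - (norm z)\<^sup>2) / (norm (1 - cnj w * z))\<^sup>2"
proof -
  have "norm (cnj w * z) \<noteq> 1"
    using assms mult_strict_mono[of "norm w" 1 "norm z" 1] by (simp add: norm_mult)
  then have nz: "norm (1 - cnj w * z) \<noteq> 0"
    by (metis eq_iff_diff_eq_0 norm_eq_zero norm_one)
  have "(norm (1 - cnj w * z))\<^sup>2 - (norm (w - z))\<^sup>2 = (1 - (norm w)\<^sup>2) * (1 - (norm z)\<^sup>2)"
    unfolding cmod_power2 by (simp add: power2_eq_square algebra_simps)
  moreover have "(norm (blaschke_factor w z))\<^sup>2 = (norm (w - z))\<^sup>2 / (norm (1 - cnj w * z))\<^sup>2"
    using assms by (simp add: blaschke_factor_def norm_mult norm_divide power_divide)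
  ultimately show ?thesis
    using nz by (simp add: field_simps)
qed

lemma norm_blaschke_factor_le_1:
  assumes "norm w < 1" "w \<noteq> 0" "norm z < 1"
  shows "norm (blaschke_factor w z) \<le> 1"
proof -
  have "0 \<le> 1 - (norm (blaschke_factor w z))\<^sup>2"
    unfolding one_minus_norm_blaschke_factor[OF assms] using assms
    by (intro divide_nonneg_nonneg mult_nonneg_nonneg) (auto simp: power_le_one)
  then show ?thesis by (simp add: abs_square_le_1)
qed

text \<open>The Weierstrass inequality 1 - sum c_n <= prod (1 - c_n), with c_n = 1 - |f n|^2, holds
  for partial products and survives the limit. Vanishing factors are allowed: the partial products
  still tend to \<open>B\<close>.\<close>

lemma one_minus_has_prod_le:
  fixes f :: "nat \<Rightarrow> complex"
  assumes "f has_prod B" "\<And>n. norm (f n) \<le> 1" "summable (\<lambda>n. 1 - (norm (f n))\<^sup>2)"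
  shows "norm B \<le> 1" "1 - (norm B)\<^sup>2 \<le> (\<Sum>n. 1 - (norm (f n))\<^sup>2)"
proof -
  have lim: "(\<lambda>k. (norm (\<Prod>n<k. f n))\<^sup>2) \<longlonglongrightarrow> (norm B)\<^sup>2"
    by (intro tendsto_intros has_prod_imp_tendsto' assms(1))
  have sq: "0 \<le> 1 - (norm (f n))\<^sup>2" for n
    using assms(2) by (simp add: power_le_one)
  have "1 - (norm (\<Prod>n<k. f n))\<^sup>2 \<le> (\<Sum>n. 1 - (norm (f n))\<^sup>2)" for k
  proof -
    have "1 - (\<Sum>n<k. 1 - (norm (f n))\<^sup>2) \<le> (\<Prod>n<k. 1 - (1 - (norm (f n))\<^sup>2))"
      using sq by (intro Weierstrass_prod_ineq) auto
    moreover have "(\<Sum>n<k. 1 - (norm (f n))\<^sup>2) \<le> (\<Sum>n. 1 - (norm (f n))\<^sup>2)"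
      using sq by (intro sum_le_suminf assms(3)) auto
    ultimately show ?thesis
      by (simp add: prod_norm[symmetric] prod_power_distrib)
  qed
  then show "1 - (norm B)\<^sup>2 \<le> (\<Sum>n. 1 - (norm (f n))\<^sup>2)"
    by (intro tendsto_upperbound[OF tendsto_diff[OF tendsto_const lim]]) auto
  have "norm (\<Prod>n<k. f n) \<le> 1" for k
    using assms(2) by (simp add: prod_norm[symmetric] prod_le_1)
  then show "norm B \<le> 1"
    by (intro tendsto_upperbound[OF tendsto_norm[OF has_prod_imp_tendsto'[OF assms(1)]]]) auto
qed

text \<open>The partial products decrease to \<open>L\<close>, and 1 - c <= exp (-c) turns their
  lower bound \<open>L > 0\<close> into the upper bound \<open>- ln L\<close> for the partial
  sums.\<close>

lemma summable_of_tendsto_prod_nonzero: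
  fixes c :: "nat \<Rightarrow> real"
  assumes c: "\<And>n. 0 \<le> c n" "\<And>n. c n \<le> 1"
    and lim: "(\<lambda>k. \<Prod>n<k. 1 - c n) \<longlonglongrightarrow> L" and "L \<noteq> 0"
  shows "summable c"
proof -
  have dec: "decseq (\<lambda>k. \<Prod>n<k. 1 - c n)"
    unfolding decseq_Suc_iff using c
    by (auto intro!: mult_right_le_one_le prod_nonneg)
  have "L \<ge> 0"
    using c by (intro tendsto_lowerbound[OF lim] always_eventually allI prod_nonneg) auto
  with \<open>L \<noteq> 0\<close> have "L > 0" by simp
  have "(\<Sum>n<k. c n) \<le> - ln L" for k
  proof -
    have "L \<le> (\<Prod>n<k. 1 - c n)" by (rule decseq_ge[OF dec lim])
    also have "\<dots> \<le> (\<Prod>n<k. exp (- c n))"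
      using c exp_ge_add_one_self[of "- c _"] by (intro prod_mono) auto
    also have "\<dots> = exp (- (\<Sum>n<k. c n))" by (simp add: exp_sum sum_negf[symmetric])
    finally have "ln L \<le> ln (exp (- (\<Sum>n<k. c n)))"
      using \<open>L > 0\<close> by (subst ln_le_cancel_iff) auto
    then show ?thesis by simp
  qed
  then show ?thesis
    using c by (intro summableI_nonneg_bounded[where x = "- ln L"]) auto
qed

text \<open>The product is evaluated at the origin, where the factor of \<open>a n\<close> has
  modulus |a n|. No factor vanishes there, so the product is nonzero and the sum of the 1 - |a n|^2
  converges.\<close>

lemma canonical_representation_blaschke_condition:
  assumes "canonical_representation \<phi> \<alpha> N I a \<mu>"
  shows "summable (\<lambda>n. if n \<in> I then 1 - (norm (a n))\<^sup>2 else 0)"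
proof -
  define c where "c = (\<lambda>n. if n \<in> I then 1 - (norm (a n))\<^sup>2 else 0)"
  define f where "f = (\<lambda>n. if n \<in> I then blaschke_factor (a n) 0 else 1)"
  have a: "norm (a n) < 1" "a n \<noteq> 0" if "n \<in> I" for n
    using assms that by (auto simp: canonical_representation_def)
  have "0 \<in> unit_disc" by simp
  then obtain B where B: "f has_prod B"
    using assms unfolding canonical_representation_def f_def by blast
  have f: "f n \<noteq> 0" "(norm (f n))\<^sup>2 = 1 - c n" for n
    using a[of n] by (auto simp: f_def c_def blaschke_factor_def norm_mult norm_divide)
  \<comment> \<open>Under \<open>has_prod\<close> the value 0 arises only from a vanishing
    factor.\<close>
  have "B \<noteq> 0"
    using B f(1) by (auto simp: has_prod_def)
  have "(\<lambda>k. (norm (\<Prod>n<k. f n))\<^sup>2) \<longlonglongrightarrow> (norm B)\<^sup>2"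
    by (intro tendsto_intros has_prod_imp_tendsto' B)
  then have "(\<lambda>k. \<Prod>n<k. 1 - c n) \<longlonglongrightarrow> (norm B)\<^sup>2"
    by (simp add: prod_norm[symmetric] prod_power_distrib f(2))
  then have "summable c"
    using \<open>B \<noteq> 0\<close> a by (intro summable_of_tendsto_prod_nonzero) (auto simp: c_def power_le_one less_imp_le)
  then show ?thesis by (simp add: c_def)
qed

text \<open>|S| = exp (-J), where J is the Poisson integral of \<open>\<mu>\<close>. At distance d
  from almost all of \<open>\<mu>\<close> the Poisson kernel lies between 0 and (1 - |z|^2) / d^2,
  and 1 - exp (-2J) <= 2J.\<close>

lemma one_minus_norm_exp_poisson_integral_le:
  assumes "finite_measure \<mu>" "space \<mu> \<subseteq> unit_circle" "norm z \<le> 1" "0 < d"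
    and d: "AE t in \<mu>. d \<le> norm (t - z)"
  defines "S \<equiv> exp (- (LINT t|\<mu>. (t + z) / (t - z)))"
  shows "norm S \<le> 1" "1 - (norm S)\<^sup>2 \<le> 2 * measure \<mu> (space \<mu>) / d\<^sup>2 * (1 - (norm z)\<^sup>2)"
proof -
  interpret finite_measure \<mu> by fact
  define J where "J = Re (LINT t|\<mu>. (t + z) / (t - z))"
  have z: "0 \<le> 1 - (norm z)\<^sup>2" using assms by (simp add: power_le_one)
  have "0 \<le> J \<and> J \<le> measure \<mu> (space \<mu>) / d\<^sup>2 * (1 - (norm z)\<^sup>2)"
  proof (cases "integrable \<mu> (\<lambda>t. (t + z) / (t - z))")
    \<comment> \<open>The Bochner integral of a non-integrable function is 0, so here J = 0.\<close>
    case False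
    then show ?thesis using z by (simp add: J_def not_integrable_integral_eq)
  next
    case True
    have J: "J = (LINT t|\<mu>. Re ((t + z) / (t - z)))"
      unfolding J_def by (rule integral_Re[OF True, symmetric])
    have bd: "AE t in \<mu>. 0 \<le> Re ((t + z) / (t - z)) \<and> Re ((t + z) / (t - z)) \<le> (1 - (norm z)\<^sup>2) / d\<^sup>2"
      using d AE_space
    proof eventually_elim
      case (elim t)
      then have "Re ((t + z) / (t - z)) = (1 - (norm z)\<^sup>2) / (norm (t - z))\<^sup>2"
        using assms(2) by (intro Re_poisson_kernel) auto
      moreover have "d\<^sup>2 \<le> (norm (t - z))\<^sup>2"
        using elim \<open>0 < d\<close> by (intro power_mono) auto
      ultimately show ?case
        using z \<open>0 < d\<close> by (auto intro!: frac_le)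
    qed
    have "J \<le> (LINT t|\<mu>. (1 - (norm z)\<^sup>2) / d\<^sup>2)"
      unfolding J using bd by (intro integral_mono_AE integrable_Re True) auto
    moreover have "0 \<le> J"
      unfolding J using bd by (intro integral_nonneg_AE) auto
    ultimately show ?thesis by simp
  qed
  moreover have S: "norm S = exp (- J)" by (simp add: S_def J_def)
  moreover have "(norm S)\<^sup>2 = exp (- 2 * J)"
    unfolding S by (simp add: power2_eq_square flip: exp_add)
  moreover have "1 - 2 * J \<le> exp (- 2 * J)"
    using exp_ge_add_one_self[of "- 2 * J"] by simp
  ultimately show "norm S \<le> 1" "1 - (norm S)\<^sup>2 \<le> 2 * measure \<mu> (space \<mu>) / d\<^sup>2 * (1 - (norm z)\<^sup>2)"
    by auto
qed

lemma one_minus_mult_le: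
  fixes x y :: real
  assumes "0 \<le> x" "x \<le> 1" "0 \<le> y" "y \<le> 1"
  shows "1 - x * y \<le> (1 - x) + (1 - y)"
  using mult_nonneg_nonneg[of "1 - x" "1 - y"] assms by (simp add: algebra_simps)

section \<open>The defect of the inner function along a radius\<close>

text \<open>The three summands of the constant come from the zero at the origin, the Blaschke
  product and the singular part. Since 1 - r is at most \<open>\<delta> / 2\<close>, moving from
  \<open>\<zeta>\<close> to r \<open>\<zeta>\<close> costs at most half of the distance
  \<open>\<delta>\<close>; hence the denominators \<open>(\<delta> / 2)\<^sup>2\<close>.\<close>

lemma canonical_representation_radial_bound:
  assumes rep: "canonical_representation \<phi> \<alpha> N I a \<mu>"
    and "0 < \<delta>" and \<zeta>: "norm \<zeta> = 1"
    and zeros: "\<And>n. n \<in> I \<Longrightarrow> \<delta> \<le> norm (\<zeta> - a n)"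
    and sing: "AE t in \<mu>. \<delta> \<le> norm (t - \<zeta>)"
    and r: "1 - \<delta> / 2 \<le> r" "0 \<le> r" "r < 1"
  shows "1 - (norm (\<phi> (of_real r * \<zeta>)))\<^sup>2 \<le>
    (real N + (\<Sum>n. if n \<in> I then 1 - (norm (a n))\<^sup>2 else 0) / (\<delta> / 2)\<^sup>2
      + 2 * measure \<mu> (space \<mu>) / (\<delta> / 2)\<^sup>2) * (1 - r\<^sup>2)"
proof -
  define z where "z = of_real r * \<zeta>"
  define f where "f = (\<lambda>n. if n \<in> I then blaschke_factor (a n) z else 1)"
  define c where "c = (\<lambda>n. if n \<in> I then 1 - (norm (a n))\<^sup>2 else 0)"
  define S where "S = exp (- (LINT t|\<mu>. (t + z) / (t - z)))"
  have z: "norm z = r" using \<zeta> r by (simp add: z_def norm_mult)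
  have dz: "norm (\<zeta> - z) = 1 - r"
  proof -
    have "\<zeta> - z = of_real (1 - r) * \<zeta>" by (simp add: z_def algebra_simps)
    then show ?thesis using \<zeta> r by (simp add: norm_mult del: of_real_diff)
  qed
  have a: "norm (a n) < 1" "a n \<noteq> 0" if "n \<in> I" for n
    using rep that by (auto simp: canonical_representation_def)
  have sing\<mu>: "singular_circle_measure \<mu>" using rep by (simp add: canonical_representation_def)
  then have fin: "finite_measure \<mu>" and space: "space \<mu> = unit_circle"
    unfolding singular_circle_measure_def
    using sets_eq_imp_space_eq[of \<mu> "restrict_space borel unit_circle"]
    by (auto simp: space_restrict_space)
  have "z \<in> unit_disc" using z r by simp
  then obtain B where B: "f has_prod B" and \<phi>: "\<phi> z = cis \<alpha> * z ^ N * B * S"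
    using rep unfolding canonical_representation_def f_def S_def by blast
  have sum_c: "summable c"
    using canonical_representation_blaschke_condition[OF rep] by (simp add: c_def)
  have fc: "norm (f n) \<le> 1" "1 - (norm (f n))\<^sup>2 \<le> c n / (\<delta> / 2)\<^sup>2 * (1 - r\<^sup>2)" for n
  proof -
    show "norm (f n) \<le> 1"
      using norm_blaschke_factor_le_1 a z r by (simp add: f_def)
    show "1 - (norm (f n))\<^sup>2 \<le> c n / (\<delta> / 2)\<^sup>2 * (1 - r\<^sup>2)"
    proof (cases "n \<in> I")
      case True
      have "cnj \<zeta> * \<zeta> = 1" using \<zeta> complex_norm_square[of \<zeta>] by (simp add: mult.commute)
      \<comment> \<open>Because |\<open>\<zeta>\<close>| = 1, the denominator of the Blaschke factor
        has the modulus of \<open>\<zeta> - of_real r * a n\<close>, which is within 1 - r of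
        \<open>\<zeta> - a n\<close>.\<close>
      then have "1 - cnj (a n) * z = \<zeta> * cnj (\<zeta> - of_real r * a n)"
        by (simp add: z_def algebra_simps)
      then have "norm (1 - cnj (a n) * z) = norm (\<zeta> - of_real r * a n)"
        using \<zeta> by (simp add: norm_mult del: complex_cnj_diff complex_cnj_mult)
      moreover have "norm (\<zeta> - a n) \<le> norm (\<zeta> - of_real r * a n) + norm (of_real (1 - r) * a n)"
        using norm_triangle_ineq4[of "\<zeta> - of_real r * a n" "of_real (1 - r) * a n"]
        by (simp add: algebra_simps)
      moreover have "norm (of_real (1 - r) * a n) \<le> 1 - r"
        using a(1)[OF True] r mult_left_mono[of "norm (a n)" 1 "1 - r"]
        by (simp add: norm_mult del: of_real_diff)
      ultimately have "\<delta> / 2 \<le> norm (1 - cnj (a n) * z)"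
        using zeros[OF True] r by linarith
      then have "(\<delta> / 2)\<^sup>2 \<le> (norm (1 - cnj (a n) * z))\<^sup>2"
        using \<open>0 < \<delta>\<close> by (intro power_mono) auto
      moreover have "0 \<le> (1 - (norm (a n))\<^sup>2) * (1 - (norm z)\<^sup>2)"
        using a[OF True] z r by (intro mult_nonneg_nonneg) (auto simp: power_le_one)
      ultimately have "1 - (norm (blaschke_factor (a n) z))\<^sup>2 \<le> (1 - (norm (a n))\<^sup>2) * (1 - (norm z)\<^sup>2) / (\<delta> / 2)\<^sup>2"
        using one_minus_norm_blaschke_factor[of "a n" z] a[OF True] z r \<open>0 < \<delta>\<close>
        by (auto intro!: divide_left_mono mult_pos_pos zero_less_power simp del: zero_less_norm_iff)
      then show ?thesis using True z by (simp add: f_def c_def)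
    qed (simp add: f_def c_def)
  qed
  have sum_bound: "summable (\<lambda>n. c n / (\<delta> / 2)\<^sup>2 * (1 - r\<^sup>2))"
    by (intro summable_mult2 summable_divide sum_c)
  have sum_f: "summable (\<lambda>n. 1 - (norm (f n))\<^sup>2)"
    using fc by (intro summable_comparison_test'[OF sum_bound]) (auto simp: power_le_one)
  have "1 - (norm B)\<^sup>2 \<le> (\<Sum>n. 1 - (norm (f n))\<^sup>2)"
    using one_minus_has_prod_le(2)[OF B fc(1) sum_f] .
  also have "\<dots> \<le> (\<Sum>n. c n / (\<delta> / 2)\<^sup>2 * (1 - r\<^sup>2))"
    by (intro suminf_le fc sum_f sum_bound)
  also have "\<dots> = (\<Sum>n. c n) / (\<delta> / 2)\<^sup>2 * (1 - r\<^sup>2)"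
    using sum_c by (subst suminf_mult2[symmetric]) (auto simp: suminf_divide summable_divide)
  finally have B1: "1 - (norm B)\<^sup>2 \<le> (\<Sum>n. c n) / (\<delta> / 2)\<^sup>2 * (1 - r\<^sup>2)" .
  have B2: "norm B \<le> 1" using one_minus_has_prod_le(1)[OF B fc(1) sum_f] .
  have "AE t in \<mu>. \<delta> / 2 \<le> norm (t - z)"
    using sing
  proof eventually_elim
    case (elim t)
    then show ?case
      using norm_triangle_ineq[of "t - z" "z - \<zeta>"] dz r by (simp add: norm_minus_commute)
  qed
  then have S: "norm S \<le> 1" "1 - (norm S)\<^sup>2 \<le> 2 * measure \<mu> (space \<mu>) / (\<delta> / 2)\<^sup>2 * (1 - r\<^sup>2)"
    using one_minus_norm_exp_poisson_integral_le[OF fin, of z "\<delta> / 2"] space z r \<open>0 < \<delta>\<close>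
    by (auto simp: S_def)
  \<comment> \<open>Bernoulli's inequality at \<open>r\<^sup>2 - 1\<close>, which is at least
    -1.\<close>
  have N: "1 - (r\<^sup>2) ^ N \<le> real N * (1 - r\<^sup>2)"
    using Bernoulli_inequality[of "r\<^sup>2 - 1" N] by (simp add: algebra_simps)
  have r2: "0 \<le> (r\<^sup>2) ^ N" "(r\<^sup>2) ^ N \<le> 1" using r by (auto simp: power_le_one)
  have B3: "(norm B)\<^sup>2 \<le> 1" and S3: "(norm S)\<^sup>2 \<le> 1" using B2 S(1) by (auto simp: power_le_one)
  have "(norm (\<phi> z))\<^sup>2 = (r\<^sup>2) ^ N * (norm B)\<^sup>2 * (norm S)\<^sup>2"
    by (simp add: \<phi> norm_mult norm_power z power_mult_distrib mult.commute flip: power_mult)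
  moreover have "1 - (r\<^sup>2) ^ N * (norm B)\<^sup>2 * (norm S)\<^sup>2 \<le> (1 - (r\<^sup>2) ^ N * (norm B)\<^sup>2) + (1 - (norm S)\<^sup>2)"
    using r2 B3 S3 by (intro one_minus_mult_le) (auto intro: mult_le_one)
  moreover have "1 - (r\<^sup>2) ^ N * (norm B)\<^sup>2 \<le> (1 - (r\<^sup>2) ^ N) + (1 - (norm B)\<^sup>2)"
    using r2 B3 by (intro one_minus_mult_le) auto
  ultimately show ?thesis
    using N B1 S(2) unfolding c_def z_def[symmetric] distrib_right by linarith
qed

section \<open>Support and atoms of a measure\<close>

text \<open>The complement of the support is covered by open sets of measure zero; by Lindelof
  countably many of them suffice.\<close>

lemma AE_measure_support:
  fixes \<mu> :: "'a::second_countable_topology measure"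
  assumes "sets \<mu> = sets (restrict_space borel S)"
  shows "AE x in \<mu>. x \<in> measure_support \<mu>"
proof -
  define \<F> where "\<F> = {U. open U \<and> emeasure \<mu> (U \<inter> space \<mu>) = 0}"
  obtain \<F>' where \<F>': "\<F>' \<subseteq> \<F>" "countable \<F>'" "\<Union>\<F>' = \<Union>\<F>"
    using Lindelof[of \<F>] unfolding \<F>_def by blast
  have space: "space \<mu> = S"
    using sets_eq_imp_space_eq[OF assms] by (simp add: space_restrict_space)
  have U: "U \<inter> space \<mu> \<in> null_sets \<mu>" if "U \<in> \<F>'" for U
  proof -
    have "open U" "emeasure \<mu> (U \<inter> space \<mu>) = 0" using that \<F>'(1) by (auto simp: \<F>_def)
    moreover have "U \<inter> space \<mu> \<in> sets \<mu>"
      unfolding assms space sets_restrict_space Int_commute[of U]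
      using \<open>open U\<close> by (intro imageI borel_open)
    ultimately show ?thesis by (intro null_setsI)
  qed
  have "(\<Union>U\<in>\<F>'. U \<inter> space \<mu>) \<in> null_sets \<mu>"
    using \<F>'(2) U by (rule null_sets_UN')
  from AE_not_in[OF this] AE_space show ?thesis
  proof eventually_elim
    case (elim x)
    then have "x \<notin> \<Union>\<F>" unfolding \<F>'(3)[symmetric] by auto
    then have "emeasure \<mu> (U \<inter> space \<mu>) \<noteq> 0" if "open U" "x \<in> U" for U
      using that by (simp add: \<F>_def) blast
    with elim(2) show ?case by (simp add: measure_support_def zero_less_iff_neq_zero)
  qed
qed

text \<open>Removing the finitely many other support points leaves an open neighbourhood of x. It
  has positive measure and agrees with {x} up to a null set, as almost every point lies in the
  support.\<close>

lemma finite_measure_support_atom: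
  fixes \<mu> :: "'a::{second_countable_topology,t1_space} measure"
  assumes sets: "sets \<mu> = sets (restrict_space borel S)"
    and fin: "finite (measure_support \<mu>)" and x: "x \<in> measure_support \<mu>"
  shows "{x} \<in> sets \<mu>" "emeasure \<mu> {x} > 0"
proof -
  let ?U = "- (measure_support \<mu> - {x})"
  have space: "space \<mu> = S"
    using sets_eq_imp_space_eq[OF sets] by (simp add: space_restrict_space)
  have "x \<in> space \<mu>" using x by (simp add: measure_support_def)
  then have "{x} = S \<inter> {x}" using space by simp
  then show meas: "{x} \<in> sets \<mu>"
    unfolding sets sets_restrict_space by (rule image_eqI) simp
  have "open ?U" using fin by (intro open_Compl finite_imp_closed) auto
  then have "0 < emeasure \<mu> (?U \<inter> space \<mu>)"
    using x by (auto simp: measure_support_def)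
  also have "emeasure \<mu> (?U \<inter> space \<mu>) = emeasure \<mu> {x}"
  proof (rule emeasure_eq_AE)
    show "AE y in \<mu>. y \<in> ?U \<inter> space \<mu> \<longleftrightarrow> y \<in> {x}"
      using AE_measure_support[OF sets] AE_space by eventually_elim (use x in auto)
    show "?U \<inter> space \<mu> \<in> sets \<mu>"
      unfolding sets space sets_restrict_space Int_commute[of ?U]
      using \<open>open ?U\<close> by (intro imageI borel_open)
  qed (fact meas)
  finally show "emeasure \<mu> {x} > 0" .
qed

section \<open>The Ahern-Clark set and the spectrum\<close>

text \<open>The closure of a finite union is the union of the closures, and a convergent sequence
  gains only its limit. A point of the circle is no zero, so it must be the limit of one of the
  subsequences.\<close>

lemma closure_finite_union_nontangential:
  assumes fu: "finite_union_of_nontangential_subsequences I a"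
    and a: "\<And>n. n \<in> I \<Longrightarrow> a n \<in> unit_disc"
    and \<zeta>: "\<zeta> \<in> closure (a ` I)" "norm \<zeta> = 1"
  obtains s where "range s \<subseteq> I" "tends_nontangentially (\<lambda>j. a (s j)) \<zeta>"
proof -
  obtain m and r :: "nat \<Rightarrow> nat \<Rightarrow> nat" where I: "I = (\<Union>k<m. range (r k))"
    and r: "\<And>k. k < m \<Longrightarrow> \<exists>\<zeta>\<in>unit_circle. tends_nontangentially (\<lambda>j. a (r k j)) \<zeta>"
    using fu unfolding finite_union_of_nontangential_subsequences_def by blast
  have "a ` I = (\<Union>k<m. range (\<lambda>j. a (r k j)))" unfolding I by auto
  moreover have "\<dots> \<subseteq> (\<Union>k<m. closure (range (\<lambda>j. a (r k j))))"
    by (intro UN_mono closure_subset order_refl)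
  ultimately have "closure (a ` I) \<subseteq> (\<Union>k<m. closure (range (\<lambda>j. a (r k j))))"
    by (intro closure_minimal closed_UN) auto
  then have "\<zeta> \<in> (\<Union>k<m. closure (range (\<lambda>j. a (r k j))))"
    using \<zeta>(1) by blast
  then obtain k where k: "k < m" "\<zeta> \<in> closure (range (\<lambda>j. a (r k j)))" by auto
  obtain \<xi> where \<xi>: "tends_nontangentially (\<lambda>j. a (r k j)) \<xi>" using r[OF k(1)] by auto
  have "closed (insert \<xi> (range (\<lambda>j. a (r k j))))"
    using \<xi> by (intro compact_imp_closed compact_sequence_with_limit) (simp add: tends_nontangentially_def)
  then have "closure (range (\<lambda>j. a (r k j))) \<subseteq> insert \<xi> (range (\<lambda>j. a (r k j)))"
    by (intro closure_minimal) auto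
  moreover have "a (r k j) \<noteq> \<zeta>" for j
  proof -
    have "r k j \<in> I" using k(1) by (auto simp: I)
    from a[OF this] \<zeta>(2) show ?thesis by auto
  qed
  ultimately have "\<xi> = \<zeta>" using k(2) by auto
  then show thesis using \<xi> k(1) by (intro that[of "r k"]) (auto simp: I)
qed

text \<open>Single terms are already unbounded: in a Stolz angle |\<open>\<zeta>\<close> - w| <= C'
  (1 - |w|^2), so the term of w is at least 1 / (C' |\<open>\<zeta>\<close> - w|).\<close>

lemma nontangential_imp_infsum_top:
  assumes s: "range s \<subseteq> I" "tends_nontangentially (\<lambda>j. a (s j)) \<zeta>" and \<zeta>: "norm \<zeta> = 1"
  shows "(\<Sum>\<^sub>\<infinity>n\<in>I. ennreal ((1 - (norm (a n))\<^sup>2) / (norm (\<zeta> - a n))\<^sup>2)) = \<infinity>"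
    (is "infsum ?t I = _")
proof (rule ccontr)
  assume "infsum ?t I \<noteq> \<infinity>"
  then obtain T where T: "infsum ?t I = ennreal T" "0 \<le> T"
    by (cases "infsum ?t I" rule: ennreal_cases) auto
  obtain C where C: "\<forall>\<^sub>F j in sequentially. a (s j) \<in> unit_disc \<and>
      norm (\<zeta> - a (s j)) \<le> C * (1 - norm (a (s j)))"
    and lim: "(\<lambda>j. a (s j)) \<longlonglongrightarrow> \<zeta>"
    using s(2) unfolding tends_nontangentially_def by blast
  \<comment> \<open>Raising the constant to at least 1 allows inequalities to be multiplied by
    it.\<close>
  define C' where "C' = max C 1"
  have "(\<lambda>j. T * C' * norm (\<zeta> - a (s j))) \<longlonglongrightarrow> T * C' * norm (\<zeta> - \<zeta>)"
    by (intro tendsto_intros lim)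
  then have "\<forall>\<^sub>F j in sequentially. T * C' * norm (\<zeta> - a (s j)) < 1"
    by (rule order_tendstoD) simp
  with C have "\<forall>\<^sub>F j in sequentially. False"
  proof eventually_elim
    case (elim j)
    define w where "w = a (s j)"
    have w: "norm w < 1" "norm (\<zeta> - w) \<le> C * (1 - norm w)" "T * C' * norm (\<zeta> - w) < 1"
      using elim by (auto simp: w_def)
    have d: "0 < norm (\<zeta> - w)" using w(1) \<zeta> by auto
    \<comment> \<open>A single term is at most the whole sum \<open>T\<close>.\<close>
    have "infsum ?t {s j} \<le> infsum ?t I"
      using s(1) by (intro infsum_mono_neutral nonneg_summable_on_complete) auto
    then have "(1 - (norm w)\<^sup>2) / (norm (\<zeta> - w))\<^sup>2 \<le> T"
      using T by (simp add: w_def)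
    then have "1 - (norm w)\<^sup>2 \<le> T * (norm (\<zeta> - w))\<^sup>2"
      using d by (simp add: pos_divide_le_eq)
    moreover have "norm (\<zeta> - w) \<le> C' * (1 - norm w)"
      by (rule order_trans[OF w(2)], rule mult_right_mono) (use w(1) in \<open>auto simp: C'_def\<close>)
    moreover have "C' * (1 - norm w) \<le> C' * (1 - (norm w)\<^sup>2)"
      using w(1) mult_left_le_one_le[of "norm w" "norm w"]
      by (intro mult_left_mono) (auto simp: C'_def power2_eq_square)
    moreover have "C' * (1 - (norm w)\<^sup>2) \<le> C' * (T * (norm (\<zeta> - w))\<^sup>2)"
      using calculation(1) by (intro mult_left_mono) (auto simp: C'_def)
    ultimately have "norm (\<zeta> - w) * 1 \<le> norm (\<zeta> - w) * (T * C' * norm (\<zeta> - w))"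
      by (simp add: power2_eq_square algebra_simps)
    then have "1 \<le> T * C' * norm (\<zeta> - w)"
      using d by (subst (asm) mult_le_cancel_left_pos)
    with w(3) show ?case by simp
  qed
  then show False by simp
qed

lemma closed_inner_spectrum:
  assumes "finite (measure_support \<mu>)"
  shows "closed (inner_spectrum I a \<mu>)"
  using assms unfolding inner_spectrum_def by (intro closed_Un closed_closure finite_imp_closed)

lemma zero_in_inner_spectrum: "n \<in> I \<Longrightarrow> a n \<in> inner_spectrum I a \<mu>"
  by (simp add: inner_spectrum_def closure_subset[THEN subsetD])

lemma ahern_clark_subset:
  assumes rep: "canonical_representation \<phi> \<alpha> N I a \<mu>"
    and zeros: "infinite I \<Longrightarrow> finite_union_of_nontangential_subsequences I a"
    and supp: "finite (measure_support \<mu>)"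
  shows "ahern_clark_set I a \<mu> \<subseteq> unit_circle - inner_spectrum I a \<mu>"
proof
  fix \<zeta> assume "\<zeta> \<in> ahern_clark_set I a \<mu>"
  then have \<zeta>: "norm \<zeta> = 1"
    and sum_fin: "(\<Sum>\<^sub>\<infinity>n\<in>I. ennreal ((1 - (norm (a n))\<^sup>2) / (norm (\<zeta> - a n))\<^sup>2)) \<noteq> \<infinity>"
    and int_fin: "2 * (\<integral>\<^sup>+t. 1 / ennreal ((norm (t - \<zeta>))\<^sup>2) \<partial>\<mu>) \<noteq> \<infinity>"
    by (auto simp: ahern_clark_set_def)
  have a: "a n \<in> unit_disc" if "n \<in> I" for n
    using rep that by (auto simp: canonical_representation_def)
  have sets: "sets \<mu> = sets (restrict_space borel unit_circle)"
    using rep by (simp add: canonical_representation_def singular_circle_measure_def)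
  have "\<zeta> \<notin> closure (a ` I)"
  proof
    assume cl: "\<zeta> \<in> closure (a ` I)"
    \<comment> \<open>A finite set of zeros is closed and stays inside the open disc, away from
      \<open>\<zeta>\<close>.\<close>
    have "infinite I"
    proof
      assume "finite I"
      then have "\<zeta> \<in> a ` I" using cl by (simp add: finite_imp_closed)
      then obtain n where "n \<in> I" "\<zeta> = a n" by blast
      with a[of n] \<zeta> show False by simp
    qed
    then obtain s where "range s \<subseteq> I" "tends_nontangentially (\<lambda>j. a (s j)) \<zeta>"
      using closure_finite_union_nontangential[OF zeros a cl \<zeta>] by blast
    with nontangential_imp_infsum_top \<zeta> sum_fin show False by blast
  qed
  moreover have "\<zeta> \<notin> measure_support \<mu>"
  proof
    assume "\<zeta> \<in> measure_support \<mu>"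
    note atom = finite_measure_support_atom[OF sets supp this]
    \<comment> \<open>The atom alone makes the integral infinite, the integrand being 1/0 at
      \<open>\<zeta>\<close>.\<close>
    have "\<infinity> = (\<infinity>::ennreal) * emeasure \<mu> {\<zeta>}"
      using atom(2) by (simp add: ennreal_top_mult)
    also have "\<dots> = (\<integral>\<^sup>+t. \<infinity> * indicator {\<zeta>} t \<partial>\<mu>)"
      using atom(1) by (simp add: nn_integral_cmult_indicator)
    also have "\<dots> \<le> (\<integral>\<^sup>+t. 1 / ennreal ((norm (t - \<zeta>))\<^sup>2) \<partial>\<mu>)"
      by (intro nn_integral_mono) (auto simp: indicator_def)
    finally show False using int_fin by (simp add: top_unique ennreal_mult_top)
  qed
  ultimately show "\<zeta> \<in> unit_circle - inner_spectrum I a \<mu>"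
    using \<zeta> by (simp add: inner_spectrum_def)
qed

text \<open>A positive distance to the closed spectrum bounds every denominator from below; what
  remains is the Blaschke sum and the total mass of \<open>\<mu>\<close>.\<close>

lemma ahern_clark_supset:
  assumes rep: "canonical_representation \<phi> \<alpha> N I a \<mu>"
    and supp: "finite (measure_support \<mu>)"
  shows "unit_circle - inner_spectrum I a \<mu> \<subseteq> ahern_clark_set I a \<mu>"
proof
  fix \<zeta> assume \<zeta>: "\<zeta> \<in> unit_circle - inner_spectrum I a \<mu>"
  then have "\<zeta> \<notin> inner_spectrum I a \<mu>" by simp
  from separate_point_closed[OF closed_inner_spectrum[OF supp] this]
  obtain \<delta> where "0 < \<delta>" and dist: "\<forall>x\<in>inner_spectrum I a \<mu>. \<delta> \<le> dist \<zeta> x"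
    by blast
  note \<delta> = \<open>0 < \<delta>\<close> bspec[OF dist]
  define c where "c = (\<lambda>n. if n \<in> I then 1 - (norm (a n))\<^sup>2 else 0)"
  have a: "norm (a n) < 1" if "n \<in> I" for n
    using rep that by (auto simp: canonical_representation_def)
  have c: "0 \<le> c n" for n using a[of n] by (simp add: c_def power_le_one less_imp_le)
  have sum_c: "summable c"
    using canonical_representation_blaschke_condition[OF rep] by (simp add: c_def)
  have sum_le: "(\<Sum>\<^sub>\<infinity>n\<in>I. ennreal ((1 - (norm (a n))\<^sup>2) / (norm (\<zeta> - a n))\<^sup>2)) \<le> ennreal (suminf c / \<delta>\<^sup>2)"
  proof (rule infsum_le_finite_sums)
    fix F assume F: "finite F" "F \<subseteq> I"
    have "(1 - (norm (a n))\<^sup>2) / (norm (\<zeta> - a n))\<^sup>2 \<le> c n / \<delta>\<^sup>2" if "n \<in> F" for n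
    proof -
      have "n \<in> I" using F that by auto
      then have "\<delta> \<le> norm (\<zeta> - a n)"
        using \<delta>(2)[OF zero_in_inner_spectrum] by (simp add: dist_norm)
      then have "\<delta>\<^sup>2 \<le> (norm (\<zeta> - a n))\<^sup>2" using \<delta>(1) by (intro power_mono) auto
      moreover have "c n = 1 - (norm (a n))\<^sup>2" using \<open>n \<in> I\<close> by (simp add: c_def)
      ultimately show ?thesis
        using c[of n] \<delta>(1) by (intro frac_le) auto
    qed
    then have "(\<Sum>n\<in>F. ennreal ((1 - (norm (a n))\<^sup>2) / (norm (\<zeta> - a n))\<^sup>2)) \<le> (\<Sum>n\<in>F. ennreal (c n / \<delta>\<^sup>2))"
      by (intro sum_mono ennreal_leI) auto
    also have "\<dots> = ennreal (sum c F / \<delta>\<^sup>2)"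
      using c by (subst sum_ennreal) (auto simp: sum_divide_distrib)
    also have "\<dots> \<le> ennreal (suminf c / \<delta>\<^sup>2)"
      using c F(1) sum_c by (intro ennreal_leI divide_right_mono sum_le_suminf) auto
    finally show "(\<Sum>n\<in>F. ennreal ((1 - (norm (a n))\<^sup>2) / (norm (\<zeta> - a n))\<^sup>2)) \<le> ennreal (suminf c / \<delta>\<^sup>2)" .
  qed (simp add: nonneg_summable_on_complete)
  have int: "(\<integral>\<^sup>+t. 1 / ennreal ((norm (t - \<zeta>))\<^sup>2) \<partial>\<mu>) < \<infinity>"
  proof -
    have sing: "finite_measure \<mu>" "sets \<mu> = sets (restrict_space borel unit_circle)"
      using rep by (auto simp: canonical_representation_def singular_circle_measure_def)
    interpret finite_measure \<mu> by fact
    \<comment> \<open>Separation from \<open>\<zeta>\<close> is known on the support only, which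
      carries almost all of \<open>\<mu>\<close>.\<close>
    have "AE t in \<mu>. 1 / ennreal ((norm (t - \<zeta>))\<^sup>2) \<le> ennreal (1 / \<delta>\<^sup>2)"
      using AE_measure_support[OF sing(2)]
    proof eventually_elim
      case (elim t)
      then have "\<delta> \<le> norm (t - \<zeta>)"
        using \<delta>(2)[of t] by (simp add: inner_spectrum_def dist_norm norm_minus_commute)
      then have "\<delta>\<^sup>2 \<le> (norm (t - \<zeta>))\<^sup>2" using \<delta>(1) by (intro power_mono) auto
      moreover have "1 / ennreal ((norm (t - \<zeta>))\<^sup>2) = ennreal (1 / (norm (t - \<zeta>))\<^sup>2)"
        using \<open>\<delta> \<le> norm (t - \<zeta>)\<close> \<delta>(1) by (subst divide_ennreal[symmetric]) auto
      ultimately show ?case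
        using \<delta>(1) by (auto intro!: ennreal_leI frac_le)
    qed
    then have "(\<integral>\<^sup>+t. 1 / ennreal ((norm (t - \<zeta>))\<^sup>2) \<partial>\<mu>) \<le> (\<integral>\<^sup>+t. ennreal (1 / \<delta>\<^sup>2) \<partial>\<mu>)"
      by (rule nn_integral_mono_AE)
    also have "\<dots> < \<infinity>"
      by (simp add: emeasure_eq_measure ennreal_mult_less_top)
    finally show ?thesis .
  qed
  have "(\<Sum>\<^sub>\<infinity>n\<in>I. ennreal ((1 - (norm (a n))\<^sup>2) / (norm (\<zeta> - a n))\<^sup>2)) < \<infinity>"
    by (rule le_less_trans[OF sum_le]) simp
  with int \<zeta> show "\<zeta> \<in> ahern_clark_set I a \<mu>"
    by (simp add: ahern_clark_set_def ennreal_mult_less_top)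
qed

section \<open>Uniform bounds on compact sets off the spectrum\<close>

text \<open>Compactness gives one distance \<open>\<delta>\<close> to the spectrum for all of
  \<open>K\<close>, so the constant of the radial bound and the starting radius are the same for
  every \<open>\<zeta>\<close>.\<close>

lemma multiplier_radially_bounded:
  assumes h: "h \<in> multiplier_space \<phi>" and \<phi>: "\<phi> ` unit_disc \<subseteq> unit_disc"
    and rep: "canonical_representation \<phi> \<alpha> N I a \<mu>"
    and supp: "finite (measure_support \<mu>)"
    and K: "compact K" "K \<subseteq> unit_circle - inner_spectrum I a \<mu>"
  obtains M r\<^sub>0 where "r\<^sub>0 < 1"
    "\<And>\<zeta> r. \<zeta> \<in> K \<Longrightarrow> r\<^sub>0 \<le> r \<Longrightarrow> r < 1 \<Longrightarrow> norm (h (of_real r * \<zeta>)) \<le> M"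
proof -
  have "K \<inter> inner_spectrum I a \<mu> = {}" using K(2) by blast
  from separate_compact_closed[OF K(1) closed_inner_spectrum[OF supp] this]
  obtain \<delta> where "0 < \<delta>" and dist: "\<forall>\<zeta>\<in>K. \<forall>x\<in>inner_spectrum I a \<mu>. \<delta> \<le> dist \<zeta> x"
    by blast
  note \<delta> = \<open>0 < \<delta>\<close> bspec[OF bspec[OF dist]]
  obtain C where C: "\<And>z. norm z < 1 \<Longrightarrow> (norm (h z))\<^sup>2 * (1 - norm z) \<le> C * (1 - (norm (\<phi> z))\<^sup>2)"
    and "0 \<le> C"
    by (rule multiplier_pointwise_bound[OF h \<phi>]) (rule that)
  define L where "L = real N + (\<Sum>n. if n \<in> I then 1 - (norm (a n))\<^sup>2 else 0) / (\<delta> / 2)\<^sup>2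
      + 2 * measure \<mu> (space \<mu>) / (\<delta> / 2)\<^sup>2"
  \<comment> \<open>The factor 2 bounds 1 + r. The maximum with 0 keeps the radius nonnegative when
    \<open>\<delta>\<close> exceeds 2, as it may for an empty spectrum.\<close>
  have bound: "norm (h (of_real r * \<zeta>)) \<le> sqrt (C * L * 2)"
    if "\<zeta> \<in> K" and r: "max 0 (1 - \<delta> / 2) \<le> r" "r < 1" for \<zeta> r
  proof -
    let ?z = "of_real r * \<zeta>"
    have \<zeta>: "norm \<zeta> = 1" using that(1) K(2) by auto
    then have z: "norm ?z = r" using r by (simp add: norm_mult)
    have zeros: "\<delta> \<le> norm (\<zeta> - a n)" if "n \<in> I" for n
      using \<delta>(2)[OF \<open>\<zeta> \<in> K\<close> zero_in_inner_spectrum[OF that]] by (simp add: dist_norm)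
    have "sets \<mu> = sets (restrict_space borel unit_circle)"
      using rep by (simp add: canonical_representation_def singular_circle_measure_def)
    from AE_measure_support[OF this] have sing: "AE t in \<mu>. \<delta> \<le> norm (t - \<zeta>)"
    proof eventually_elim
      case (elim t)
      then show ?case
        using \<delta>(2)[OF \<open>\<zeta> \<in> K\<close>, of t] by (simp add: inner_spectrum_def dist_norm norm_minus_commute)
    qed
    have A: "1 - (norm (\<phi> ?z))\<^sup>2 \<le> L * (1 - r\<^sup>2)"
      unfolding L_def
      using r by (intro canonical_representation_radial_bound[OF rep \<delta>(1) \<zeta> zeros sing]) auto
    have "(norm (h ?z))\<^sup>2 * (1 - r) \<le> C * (1 - (norm (\<phi> ?z))\<^sup>2)"
      using C[of ?z] z r by simp
    also have "\<dots> \<le> C * (L * (1 - r\<^sup>2))"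
      using A \<open>0 \<le> C\<close> by (rule mult_left_mono)
    \<comment> \<open>The factor 1 - r lost in point evaluation reappears here and cancels.\<close>
    also have "\<dots> = C * L * (1 + r) * (1 - r)"
      by (simp add: power2_eq_square algebra_simps)
    finally have B: "(norm (h ?z))\<^sup>2 \<le> C * L * (1 + r)"
      using r by (subst (asm) mult_le_cancel_right_pos) auto
    \<comment> \<open>The sign is read off \<open>B\<close>, whose left side is a square.\<close>
    have "0 \<le> C * L"
    proof -
      have "0 \<le> C * L * (1 + r)" using order_trans[OF zero_le_power2 B] .
      then show ?thesis using r by (simp add: zero_le_mult_iff)
    qed
    then have "C * L * (1 + r) \<le> C * L * 2"
      using r by (intro mult_left_mono) auto
    with B have "(norm (h ?z))\<^sup>2 \<le> C * L * 2" by linarith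
    then show ?thesis by (rule real_le_rsqrt)
  qed
  show thesis
  proof (rule that)
    show "max 0 (1 - \<delta> / 2) < 1" using \<delta>(1) by simp
  qed (fact bound)
qed

theorem corollary2p6:
  fixes \<phi> :: "complex \<Rightarrow> complex" and \<alpha> :: real and N :: nat
    and I :: "nat set" and a :: "nat \<Rightarrow> complex" and \<mu> :: "complex measure"
  assumes "inner_function \<phi>"
    and "canonical_representation \<phi> \<alpha> N I a \<mu>"
    and "infinite I \<Longrightarrow> finite_union_of_nontangential_subsequences I a"
    and "finite (measure_support \<mu>)"
  shows "ahern_clark_set I a \<mu> = unit_circle - inner_spectrum I a \<mu> \<and>
    (\<forall>h\<in>multiplier_space \<phi>. \<forall>K. relatively_compact_in K (ahern_clark_set I a \<mu>) \<longrightarrow>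
       essentially_bounded_on h K)"
proof (intro conjI ballI allI impI)
  show E: "ahern_clark_set I a \<mu> = unit_circle - inner_spectrum I a \<mu>"
    using ahern_clark_subset[OF assms(2,3,4)] ahern_clark_supset[OF assms(2,4)]
    by (rule subset_antisym)
  fix h K
  assume h: "h \<in> multiplier_space \<phi>" and "relatively_compact_in K (ahern_clark_set I a \<mu>)"
  then have K: "compact (closure K)" "closure K \<subseteq> unit_circle - inner_spectrum I a \<mu>"
    by (simp_all add: relatively_compact_in_def E)
  have \<phi>: "\<phi> ` unit_disc \<subseteq> unit_disc"
    using assms(1) by (simp add: inner_function_def)
  obtain M r\<^sub>0 where M: "r\<^sub>0 < 1"
    "\<And>\<zeta> r. \<zeta> \<in> closure K \<Longrightarrow> r\<^sub>0 \<le> r \<Longrightarrow> r < 1 \<Longrightarrow> norm (h (of_real r * \<zeta>)) \<le> M"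
    by (rule multiplier_radially_bounded[OF h \<phi> assms(2,4) K]) (rule that)
  \<comment> \<open>The bound holds at every point of \<open>K\<close>; the maximum covers points
    where the radial limit does not exist.\<close>
  have "norm (radial_limit h \<zeta>) \<le> max M (norm (THE l::complex. False))" if "\<zeta> \<in> K" for \<zeta>
    by (rule norm_radial_limit_le[where f = h and \<zeta> = \<zeta>, OF _ M(1)])
      (rule M(2)[OF closure_subset[THEN subsetD, OF that]])
  then show "essentially_bounded_on h K"
    unfolding essentially_bounded_on_def
    by (intro exI[of _ "max M (norm (THE l::complex. False))"]) simp
qed

end
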